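(* Let $R$ be a commutative ring with $1$, let $n\geq 5$, and let $w$ be any column of a matrix in $\bigwedge^{2}\mathrm{GL}_n(R)$. Set $$T_1:=\bigwedge^{2}t_{2,3}(w_{45})\cdot\bigwedge^{2}t_{2,4}(-w_{35})\cdot\bigwedge^{2}t_{2,5}(w_{34}).$$ Then $T_1\cdot w=w$.
   Context: Let $[n]=\{1,\dots,n\}$ and let $\bigwedge^{2}[n]$ be the set of two-element subsets $\{i_1,i_2\}$ of $[n]$, written in ascending order $i_1<i_2$; it has $N=\binom{n}{2}$ elements. The module $\bigwedge^{2}(R^n)\cong R^N$ has basis $e_{i_1}\wedge e_{i_2}$, $i_1<i_2$; matrices in $\mathrm{GL}_N(R)$ are indexed by pairs of elements of $\bigwedge^{2}[n]$, and for a column $w\in R^N$ and $i<j$, $w_{ij}$ is the coordinate of $w$ at $e_i\wedge e_j$. The Cauchy–Binet homomorphism $\bigwedge^{2}:\mathrm{GL}_n(R)\to\mathrm{GL}_N(R)$ is given by $g(e_i\wedge e_j)=(ge_i)\wedge(ge_j)$, i.e. $\left(\bigwedge^{2}(x)\right)_{(i_1,i_2),(j_1,j_2)}=x_{i_1,j_1}x_{i_2,j_2}-x_{i_1,j_2}x_{i_2,j_1}$. It is functorial in $R$, and $\bigwedge^{2}\mathrm{GL}_n(R)$ denotes the group of $R$-points of the (scheme-theoretic) image of the group scheme $\mathrm{GL}_n$ under the resulting morphism of group schemes $\mathrm{GL}_n\to\mathrm{GL}_N$. It is a subgroup of $\mathrm{GL}_N(R)$ containing, in general strictly, the image $\bigwedge^{2}(\mathrm{GL}_n(R))$.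 For $n\geq 3$, $n\neq 4$, it coincides with the stabilizer in $\mathrm{GL}_N(R)$ of the Plücker ideal of $R[x_I: I\in\bigwedge^{2}[n]]$ (the ideal generated by the standard short Plücker relations). For $1\leq i\neq j\leq n$ and $\xi\in R$, $t_{i,j}(\xi)=e+\xi e_{i,j}\in\mathrm{GL}_n(R)$ is the elementary transvection, and $\bigwedge^{2}t_{i,j}(\xi)$ is its image under $\bigwedge^{2}$. *)

theory Defs
  imports
    "Jordan_Normal_Form.Gauss_Jordan_Elimination"
    "HOL-Library.Poly_Mapping"
begin

section \<open>Second exterior powers of matrices\<close>

text \<open>
  Labels in \<open>[n]\<close> start at 1, whereas rows and columns of type \<open>'a mat\<close> start at 0.
  The list \<open>pairs n\<close> enumerates the two-element subsets of \<open>[n]\<close>, written in ascending order,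
  lexicographically; this fixes the ordered basis \<open>e\<^sub>i \<and> e\<^sub>j\<close> of the second exterior power.
\<close>

definition pairs :: "nat \<Rightarrow> (nat \<times> nat) list" where
  "pairs n = [(i, j). i \<leftarrow> [1..<Suc n], j \<leftarrow> [Suc i..<Suc n]]"

lemma set_pairs: "set (pairs n) = {(i, j). 1 \<le> i \<and> i < j \<and> j \<le> n}"
  by (force simp: pairs_def simp del: upt_Suc)

lemma distinct_concat_tagged:
  "distinct is \<Longrightarrow> (\<And>i. distinct (f i)) \<Longrightarrow> distinct (concat (map (\<lambda>i. map (Pair i) (f i)) is))"
  by (induction "is") (auto simp: distinct_map inj_on_def)

lemma distinct_pairs: "distinct (pairs n)"
  unfolding pairs_def by (rule distinct_concat_tagged) auto

lemma length_pairs: "length (pairs n) = n choose 2"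
proof -
  have "length (pairs n) = (\<Sum>i=1..<Suc n. n - i)"
    unfolding pairs_def
    by (simp add: length_concat comp_def interv_sum_list_conv_sum_set_nat del: upt_Suc)
  also have "\<dots> = (\<Sum>i<n. i)"
    by (rule sum.reindex_bij_witness[where i = "\<lambda>i. n - i" and j = "\<lambda>i. n - i"]) auto
  also have "\<dots> = n choose 2"
    by (induction n) (auto simp: numeral_2_eq_2)
  finally show ?thesis .
qed

definition wedge2_coord :: "nat \<Rightarrow> 'a vec \<Rightarrow> nat \<Rightarrow> nat \<Rightarrow> 'a" where
  "wedge2_coord n w i j = w $ (THE k. k < length (pairs n) \<and> pairs n ! k = (i, j))"

definition wedge2 :: "'a::comm_ring_1 mat \<Rightarrow> 'a mat" where
  "wedge2 x = (let n = dim_row x in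
     mat (n choose 2) (n choose 2) (\<lambda>(a, b).
       case pairs n ! a of (i1, i2) \<Rightarrow> case pairs n ! b of (j1, j2) \<Rightarrow>
         x $$ (i1 - 1, j1 - 1) * x $$ (i2 - 1, j2 - 1)
         - x $$ (i1 - 1, j2 - 1) * x $$ (i2 - 1, j1 - 1)))"

definition transvection :: "nat \<Rightarrow> nat \<Rightarrow> nat \<Rightarrow> 'a::comm_ring_1 \<Rightarrow> 'a mat" where
  "transvection n i j \<xi> = addrow_mat n \<xi> (i - 1) (j - 1)"


section \<open>Integral polynomials and the coordinate ring of the general linear group scheme\<close>

type_synonym 'v zpoly = "('v \<Rightarrow>\<^sub>0 nat) \<Rightarrow>\<^sub>0 int"

definition zvar :: "'v \<Rightarrow> 'v zpoly" where
  "zvar x = Poly_Mapping.single (Poly_Mapping.single x 1) 1"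

definition indets :: "'v zpoly \<Rightarrow> 'v set" where
  "indets p = (\<Union>m \<in> Poly_Mapping.keys p. Poly_Mapping.keys m)"

definition zeval :: "('v \<Rightarrow> 'a::comm_ring_1) \<Rightarrow> 'v zpoly \<Rightarrow> 'a" where
  "zeval v p = (\<Sum>m \<in> Poly_Mapping.keys p.
     of_int (Poly_Mapping.lookup p m) *
     (\<Prod>x \<in> Poly_Mapping.keys m. v x ^ Poly_Mapping.lookup m x))"

text \<open>
  The group scheme \<open>GL\<^sub>m\<close> over the integers is presented as the scheme of pairs \<open>(X, Y)\<close> of
  mutually inverse \<open>m \<times> m\<close> matrices, so its coordinate ring is the polynomial ring in the
  entries of \<open>X\<close> and \<open>Y\<close> modulo the ideal generated by the entries of \<open>XY - 1\<close> and \<open>YX - 1\<close>.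
\<close>

datatype gl_var = Entry nat nat | InvEntry nat nat

definition gl_vars :: "nat \<Rightarrow> gl_var set" where
  "gl_vars m = {Entry i j | i j. i < m \<and> j < m} \<union> {InvEntry i j | i j. i < m \<and> j < m}"

definition generic_mat :: "nat \<Rightarrow> gl_var zpoly mat" where
  "generic_mat m = mat m m (\<lambda>(i, j). zvar (Entry i j))"

definition generic_inv :: "nat \<Rightarrow> gl_var zpoly mat" where
  "generic_inv m = mat m m (\<lambda>(i, j). zvar (InvEntry i j))"

text \<open>
  The ideal is taken in the polynomial ring in all variables of type \<open>gl_var\<close>; for polynomials in
  \<open>gl_vars m\<close> membership is the same as in the ideal of the smaller polynomial ring, since the
  variables outside \<open>gl_vars m\<close> can be set to 0.
\<close>

definition gl_ideal :: "nat \<Rightarrow> gl_var zpoly set" where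
  "gl_ideal m = Modules.module.span (*)
     (elements_mat (generic_mat m * generic_inv m - 1\<^sub>m m)
      \<union> elements_mat (generic_inv m * generic_mat m - 1\<^sub>m m))"

definition gl_eval :: "gl_var zpoly \<Rightarrow> 'a::comm_ring_1 mat \<Rightarrow> 'a mat \<Rightarrow> 'a" where
  "gl_eval p A B = zeval (\<lambda>v. case v of Entry i j \<Rightarrow> A $$ (i, j) | InvEntry i j \<Rightarrow> B $$ (i, j)) p"


section \<open>The scheme-theoretic image of the Cauchy--Binet morphism\<close>

text \<open>
  With \<open>N = n choose 2\<close>, the morphism from \<open>GL\<^sub>n\<close> to \<open>GL\<^sub>N\<close> sends a pair \<open>(X, Y)\<close> of mutually
  inverse matrices to \<open>(wedge2 X, wedge2 Y)\<close>. The set \<open>wedge2_kernel n\<close> consists of the polynomials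
  representing elements of the kernel of the induced map of coordinate rings
  \<open>\<int>[GL\<^sub>N] \<rightarrow> \<int>[GL\<^sub>n]\<close>. As both schemes are affine, this kernel is the ideal of the
  scheme-theoretic image, so an \<open>R\<close>-point of the image is an \<open>R\<close>-point of \<open>GL\<^sub>N\<close> at which the
  whole kernel vanishes.
\<close>

definition wedge2_kernel :: "nat \<Rightarrow> gl_var zpoly set" where
  "wedge2_kernel n = {p. indets p \<subseteq> gl_vars (n choose 2) \<and>
     gl_eval p (wedge2 (generic_mat n)) (wedge2 (generic_inv n)) \<in> gl_ideal n}"

definition wedge2_GL :: "nat \<Rightarrow> 'a::comm_ring_1 mat set" where
  "wedge2_GL n = {A \<in> carrier_mat (n choose 2) (n choose 2).
     \<exists>B \<in> carrier_mat (n choose 2) (n choose 2).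
       inverts_mat A B \<and> inverts_mat B A \<and> (\<forall>p \<in> wedge2_kernel n. gl_eval p A B = 0)}"

end

theory Submission
  imports Defs
begin

text \<open>
  Read a vector \<open>w\<close> of the second exterior power as an alternating matrix \<open>W\<close> with entries
  \<open>W i j = w\<^sub>i\<^sub>j = - w\<^sub>j\<^sub>i\<close>. Then \<open>wedge2 x\<close> acts by congruence, \<open>W \<mapsto> x W x\<^sup>T\<close>
  (lemma \<open>alt_coord_wedge2_mult\<close>), so the transvection \<open>t\<^bsub>p,q\<^esub>(\<xi>)\<close> adds \<open>\<xi>\<close> times row \<open>q\<close> of \<open>W\<close>
  to row \<open>p\<close>, and likewise for columns. For fixed \<open>p\<close> and three labels \<open>q, r, s\<close> different from
  \<open>p\<close>, the three additions do not disturb each other, because they read only rows \<open>q, r, s\<close>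
  and change these rows only in column \<open>p\<close>. With the coefficients \<open>w\<^sub>r\<^sub>s\<close>,
  \<open>- w\<^sub>q\<^sub>s\<close> and \<open>w\<^sub>q\<^sub>r\<close> their combined effect on the entry at \<open>(p, k)\<close>, \<open>k \<noteq> p\<close>, is to add
  \<open>w\<^sub>r\<^sub>s W q k - w\<^sub>q\<^sub>s W r k + w\<^sub>q\<^sub>r W s k\<close>. This is \<open>0\<close> by a Pluecker relation (trivially if \<open>k\<close>
  is one of \<open>q, r, s\<close>).

  The columns of a matrix in the image scheme satisfy the Pluecker relations even if the matrix
  is not itself a second exterior power: the relation is a polynomial with integral coefficients
  in the matrix entries, it holds for the \<open>2 \<times> 2\<close> minors of a generic matrix, so it lies in
  \<open>wedge2_kernel\<close> and vanishes at all points of the image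
  (lemmas \<open>plucker_in_wedge2_kernel\<close> and \<open>column_plucker\<close>).
\<close>

section \<open>Vectors of the second exterior power as alternating matrices\<close>

lemma wedge2_coord_nth:
  assumes "k < length (pairs n)" and "pairs n ! k = (i, j)"
  shows "wedge2_coord n w i j = w $ k"
proof -
  have "(THE k. k < length (pairs n) \<and> pairs n ! k = (i, j)) = k"
    using assms nth_eq_iff_index_eq[OF distinct_pairs] by (intro the_equality) (auto, metis)
  then show ?thesis by (simp add: wedge2_coord_def)
qed

lemma obtain_pair_index:
  assumes "1 \<le> i" "i < j" "j \<le> n"
  obtains k where "k < n choose 2" "pairs n ! k = (i, j)"
proof -
  have "(i, j) \<in> set (pairs n)" using assms by (simp add: set_pairs)
  then show ?thesis using that by (auto simp: in_set_conv_nth length_pairs)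
qed

lemma nth_pairs_bounds:
  assumes "k < n choose 2" "pairs n ! k = (i, j)"
  shows "1 \<le> i" "i < j" "j \<le> n"
proof -
  have "(i, j) \<in> set (pairs n)" using assms nth_mem[of k "pairs n"] by (simp add: length_pairs)
  then show "1 \<le> i" "i < j" "j \<le> n" by (auto simp: set_pairs)
qed

definition alt_coord :: "nat \<Rightarrow> 'a::comm_ring_1 vec \<Rightarrow> nat \<Rightarrow> nat \<Rightarrow> 'a" where
  "alt_coord n w i j =
    (if i < j then wedge2_coord n w i j else if j < i then - wedge2_coord n w j i else 0)"

lemma alt_coord_less: "i < j \<Longrightarrow> alt_coord n w i j = wedge2_coord n w i j"
  by (simp add: alt_coord_def)

lemma alt_coord_swap: "alt_coord n w j i = - alt_coord n w i j"
  by (simp add: alt_coord_def)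

lemma alt_coord_self [simp]: "alt_coord n w i i = 0"
  by (simp add: alt_coord_def)

lemma vec_eq_alt_coordI:
  assumes "v \<in> carrier_vec (n choose 2)" "w \<in> carrier_vec (n choose 2)"
    and "\<And>i j. 1 \<le> i \<Longrightarrow> i < j \<Longrightarrow> j \<le> n \<Longrightarrow> alt_coord n v i j = alt_coord n w i j"
  shows "v = w"
proof (rule eq_vecI)
  fix k assume "k < dim_vec w"
  then have k: "k < n choose 2" using assms(2) by simp
  obtain i j where ij: "pairs n ! k = (i, j)" by force
  show "v $ k = w $ k"
    using assms(3)[of i j] nth_pairs_bounds[OF k ij] k
    by (simp add: alt_coord_less length_pairs wedge2_coord_nth[OF _ ij])
qed (use assms in simp)

lemma sum_alternating_square:
  fixes W :: "nat \<Rightarrow> nat \<Rightarrow> 'a::comm_ring_1"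
  assumes swap: "\<And>p q. W q p = - W p q" and diag: "\<And>p. W p p = 0"
  shows "(\<Sum>p=1..n. \<Sum>q=1..n. f p * g q * W p q) =
    (\<Sum>(p, q)\<in>set (pairs n). (f p * g q - f q * g p) * W p q)"
proof -
  let ?h = "\<lambda>(p, q). f p * g q * W p q"
  let ?L = "set (pairs n)"
  let ?U = "{(p, q). 1 \<le> q \<and> q < p \<and> p \<le> n}"
  let ?D = "{(p, q). p = q \<and> 1 \<le> p \<and> p \<le> n}"
  have sub: "?U \<subseteq> {1..n} \<times> {1..n}" "?D \<subseteq> {1..n} \<times> {1..n}" by auto
  have fin: "finite ?U" "finite ?D" using sub by (auto elim!: finite_subset)
  have disjoint: "?L \<inter> ?U = {}" "(?L \<union> ?U) \<inter> ?D = {}" by (auto simp: set_pairs)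
  have split: "{1..n} \<times> {1..n} = (?L \<union> ?U) \<union> ?D" by (auto simp: set_pairs)
  have "(\<Sum>p=1..n. \<Sum>q=1..n. f p * g q * W p q) = sum ?h ({1..n} \<times> {1..n})"
    by (simp add: sum.cartesian_product)
  also have "\<dots> = sum ?h ?L + sum ?h ?U + sum ?h ?D"
    unfolding split
    by (simp only: sum.union_disjoint[OF finite_UnI[OF List.finite_set fin(1)] fin(2) disjoint(2)]
        sum.union_disjoint[OF List.finite_set fin(1) disjoint(1)])
  also have "sum ?h ?D = 0" by (rule sum.neutral) (auto simp: diag)
  also have "sum ?h ?U = (\<Sum>(p, q)\<in>?L. f q * g p * W q p)"
    by (rule sum.reindex_bij_witness[where i = prod.swap and j = prod.swap])
      (auto simp: set_pairs)
  also have "sum ?h ?L + (\<Sum>(p, q)\<in>?L. f q * g p * W q p) + 0 =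
      (\<Sum>(p, q)\<in>?L. (f p * g q - f q * g p) * W p q)"
    unfolding add_0_right sum.distrib[symmetric]
  proof (rule sum.cong[OF refl], clarify)
    fix p q
    show "f p * g q * W p q + f q * g p * W q p = (f p * g q - f q * g p) * W p q"
      unfolding swap[of p q] by (simp add: algebra_simps)
  qed
  finally show ?thesis .
qed

lemma wedge2_carrier [simp]:
  "x \<in> carrier_mat n n \<Longrightarrow> wedge2 x \<in> carrier_mat (n choose 2) (n choose 2)"
  by (simp add: wedge2_def Let_def)

lemma wedge2_index:
  assumes "x \<in> carrier_mat n n" "a < n choose 2" "b < n choose 2"
    and "pairs n ! a = (i1, i2)" "pairs n ! b = (j1, j2)"
  shows "wedge2 x $$ (a, b) = x $$ (i1 - 1, j1 - 1) * x $$ (i2 - 1, j2 - 1)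
    - x $$ (i1 - 1, j2 - 1) * x $$ (i2 - 1, j1 - 1)"
  using assms by (simp add: wedge2_def Let_def)

text \<open>
  Expanding \<open>x W x\<^sup>T\<close> at \<open>(i, j)\<close> over all ordered pairs of labels and collecting the terms for
  \<open>(p, q)\<close> and \<open>(q, p)\<close> produces the \<open>2 \<times> 2\<close> minors of \<open>x\<close>.
\<close>

lemma alt_coord_wedge2_mult:
  assumes x: "x \<in> carrier_mat n n" and w: "w \<in> carrier_vec (n choose 2)"
    and ij: "1 \<le> i" "i \<le> n" "1 \<le> j" "j \<le> n"
  shows "alt_coord n (wedge2 x *\<^sub>v w) i j =
    (\<Sum>p=1..n. \<Sum>q=1..n. x $$ (i - 1, p - 1) * x $$ (j - 1, q - 1) * alt_coord n w p q)"
proof -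
  let ?W = "alt_coord n w"
  define S where
    "S i j = (\<Sum>p=1..n. \<Sum>q=1..n. x $$ (i - 1, p - 1) * x $$ (j - 1, q - 1) * ?W p q)" for i j
  define minor where "minor i j p q =
    x $$ (i - 1, p - 1) * x $$ (j - 1, q - 1) - x $$ (i - 1, q - 1) * x $$ (j - 1, p - 1)" for i j p q
  have S_pairs: "S i j = (\<Sum>(p, q)\<in>set (pairs n). minor i j p q * ?W p q)" for i j
    unfolding S_def minor_def
    by (rule sum_alternating_square) (rule alt_coord_swap, rule alt_coord_self)
  have minor_swap: "minor j i p q = - minor i j p q" and minor_self: "minor i i p q = 0" for i j p q
    by (simp_all add: minor_def mult.commute)
  have S_swap: "S j i = - S i j" for i j
    unfolding S_pairs minor_swap[of j i] by (simp add: sum_negf case_prod_unfold)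
  have S_self: "S i i = 0" for i
    by (simp add: S_pairs minor_self)
  have less: "alt_coord n (wedge2 x *\<^sub>v w) i j = S i j"
    if lt: "1 \<le> i" "i < j" "j \<le> n" for i j
  proof -
    let ?h = "\<lambda>(p, q). minor i j p q * ?W p q"
    obtain k where k: "k < n choose 2" "pairs n ! k = (i, j)"
      by (rule obtain_pair_index[OF lt])
    have "alt_coord n (wedge2 x *\<^sub>v w) i j = (wedge2 x *\<^sub>v w) $ k"
      using lt k(1) by (simp add: alt_coord_less length_pairs wedge2_coord_nth[OF _ k(2)])
    also have "\<dots> = (\<Sum>b<n choose 2. wedge2 x $$ (k, b) * w $ b)"
      using k w wedge2_carrier[OF x] by (auto simp: scalar_prod_def atLeast0LessThan)
    also have "\<dots> = (\<Sum>b<n choose 2. ?h (pairs n ! b))"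
    proof (rule sum.cong[OF refl])
      fix b assume "b \<in> {..<n choose 2}"
      then have b: "b < n choose 2" by simp
      obtain p q where pq: "pairs n ! b = (p, q)" by force
      have "?W p q = w $ b"
        using nth_pairs_bounds[OF b pq] b
        by (simp add: alt_coord_less length_pairs wedge2_coord_nth[OF _ pq])
      then show "wedge2 x $$ (k, b) * w $ b = ?h (pairs n ! b)"
        by (simp add: wedge2_index[OF x k(1) b k(2) pq] pq minor_def)
    qed
    also have "\<dots> = sum ?h (set (pairs n))"
      by (simp add: sum.distinct_set_conv_list[OF distinct_pairs] sum_list_sum_nth
          length_pairs atLeast0LessThan)
    also have "\<dots> = S i j" by (rule S_pairs[symmetric])
    finally show ?thesis .
  qed
  consider "i < j" | "j < i" | "i = j" by linarith
  then have "alt_coord n (wedge2 x *\<^sub>v w) i j = S i j"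
  proof cases
    case 1
    then show ?thesis using less ij by blast
  next
    case 2
    then show ?thesis
      using less[of j i] ij S_swap[of j i] alt_coord_swap[of n "wedge2 x *\<^sub>v w" i j] by simp
  next
    case 3
    then show ?thesis using S_self by simp
  qed
  then show ?thesis by (simp only: S_def)
qed

section \<open>The action of transvections\<close>

lemma transvection_carrier [simp]: "transvection n p q \<xi> \<in> carrier_mat n n"
  by (simp add: transvection_def)

lemma transvection_index:
  assumes "1 \<le> i" "i \<le> n" "1 \<le> j" "j \<le> n" "1 \<le> p" "1 \<le> q"
  shows "transvection n p q \<xi> $$ (i - 1, j - 1) =
    (if j = i then 1 else 0) + (if j = q then if i = p then \<xi> else 0 else 0)"
  using assms by (auto simp: transvection_def addrow_mat_def)

text \<open>
  For \<open>a = b = p\<close> the product \<open>x W x\<^sup>T\<close> also has the term \<open>\<xi>\<^sup>2 W q q\<close>, which is \<open>0\<close> since \<open>W\<close>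
  is alternating. This is why the action is affine in \<open>\<xi>\<close>.
\<close>

lemma alt_coord_wedge2_transvection:
  assumes w: "w \<in> carrier_vec (n choose 2)"
    and ab: "1 \<le> a" "a \<le> n" "1 \<le> b" "b \<le> n"
    and pq: "1 \<le> p" "1 \<le> q" "q \<le> n"
  shows "alt_coord n (wedge2 (transvection n p q \<xi>) *\<^sub>v w) a b =
    alt_coord n w a b + (if a = p then \<xi> * alt_coord n w q b else 0)
      + (if b = p then \<xi> * alt_coord n w a q else 0)"
proof -
  let ?W = "alt_coord n w"
  define c where "c i = (if i = p then \<xi> else 0)" for i
  have row: "(\<Sum>j=1..n. transvection n p q \<xi> $$ (i - 1, j - 1) * f j) = f i + c i * f q"
    if "1 \<le> i" "i \<le> n" for i and f :: "nat \<Rightarrow> 'a"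
  proof -
    have "(\<Sum>j=1..n. transvection n p q \<xi> $$ (i - 1, j - 1) * f j) =
        (\<Sum>j=1..n. (if j = i then f j else 0) + (if j = q then c i * f j else 0))"
      by (rule sum.cong[OF refl], subst transvection_index)
        (use that pq in \<open>auto simp: c_def algebra_simps\<close>)
    then show ?thesis using that pq by (simp add: sum.distrib)
  qed
  have "alt_coord n (wedge2 (transvection n p q \<xi>) *\<^sub>v w) a b =
      (\<Sum>i=1..n. transvection n p q \<xi> $$ (a - 1, i - 1) *
        (\<Sum>j=1..n. transvection n p q \<xi> $$ (b - 1, j - 1) * ?W i j))"
    by (simp add: alt_coord_wedge2_mult[OF transvection_carrier w ab] sum_distrib_left mult.assoc)
  also have "\<dots> = ?W a b + c b * ?W a q + c a * (?W q b + c b * ?W q q)"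
    using ab by (simp only: row)
  finally show ?thesis by (simp add: c_def)
qed

text \<open>
  The product of the three transvections is the identity plus the matrix with
  \<open>v = \<alpha> e\<^sub>q + \<beta> e\<^sub>r + \<gamma> e\<^sub>s\<close> as row \<open>p\<close>. Congruence by it adds \<open>v W\<close> to row \<open>p\<close> of the alternating
  matrix \<open>W\<close> of \<open>w\<close>, and the transpose to column \<open>p\<close>; the hypothesis \<open>rel\<close> is \<open>v W = 0\<close>.
\<close>

lemma wedge2_transvections_fix:
  assumes w: "w \<in> carrier_vec (n choose 2)"
    and p: "1 \<le> p" "p \<noteq> q" "p \<noteq> r" "p \<noteq> s"
    and qrs: "1 \<le> q" "q \<le> n" "1 \<le> r" "r \<le> n" "1 \<le> s" "s \<le> n"
    and rel: "\<And>k. 1 \<le> k \<Longrightarrow> k \<le> n \<Longrightarrow>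
      \<alpha> * alt_coord n w q k + \<beta> * alt_coord n w r k + \<gamma> * alt_coord n w s k = 0"
  shows "(wedge2 (transvection n p q \<alpha>) * wedge2 (transvection n p r \<beta>)
    * wedge2 (transvection n p s \<gamma>)) *\<^sub>v w = w"
proof -
  let ?N = "n choose 2"
  let ?A = "wedge2 (transvection n p q \<alpha>)"
  let ?B = "wedge2 (transvection n p r \<beta>)"
  let ?C = "wedge2 (transvection n p s \<gamma>)"
  have car: "?A \<in> carrier_mat ?N ?N" "?B \<in> carrier_mat ?N ?N" "?C \<in> carrier_mat ?N ?N"
    by simp_all
  have Cw: "?C *\<^sub>v w \<in> carrier_vec ?N" by (rule mult_mat_vec_carrier[OF car(3) w])
  have BCw: "?B *\<^sub>v (?C *\<^sub>v w) \<in> carrier_vec ?N" by (rule mult_mat_vec_carrier[OF car(2) Cw])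
  have ABCw: "?A *\<^sub>v (?B *\<^sub>v (?C *\<^sub>v w)) \<in> carrier_vec ?N"
    by (rule mult_mat_vec_carrier[OF car(1) BCw])
  have "(?A * ?B * ?C) *\<^sub>v w = ?A *\<^sub>v (?B *\<^sub>v (?C *\<^sub>v w))"
    by (simp add: assoc_mult_mat_vec[OF mult_carrier_mat[OF car(1,2)] car(3) w]
        assoc_mult_mat_vec[OF car(1,2) Cw])
  also have "\<dots> = w"
  proof (rule vec_eq_alt_coordI[OF ABCw w])
    fix i j assume ij: "1 \<le> i" "i < j" "j \<le> n"
    have rel': "\<alpha> * alt_coord n w k q + \<beta> * alt_coord n w k r + \<gamma> * alt_coord n w k s = 0"
      if "1 \<le> k" "k \<le> n" for k
    proof -
      have "\<alpha> * alt_coord n w k q + \<beta> * alt_coord n w k r + \<gamma> * alt_coord n w k s =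
          - (\<alpha> * alt_coord n w q k + \<beta> * alt_coord n w r k + \<gamma> * alt_coord n w s k)"
        unfolding alt_coord_swap[of n w k q] alt_coord_swap[of n w k r] alt_coord_swap[of n w k s]
        by simp
      then show ?thesis using rel[OF that] by simp
    qed
    show "alt_coord n (?A *\<^sub>v (?B *\<^sub>v (?C *\<^sub>v w))) i j = alt_coord n w i j"
    proof (cases "i = p")
      case True
      then show ?thesis
        using ij p qrs rel[of j]
        by (simp add: alt_coord_wedge2_transvection[OF BCw] alt_coord_wedge2_transvection[OF Cw]
            alt_coord_wedge2_transvection[OF w] add_ac)
    next
      case False
      then show ?thesis
        using ij p qrs rel'[of i]
        by (simp add: alt_coord_wedge2_transvection[OF BCw] alt_coord_wedge2_transvection[OF Cw]
            alt_coord_wedge2_transvection[OF w] add_ac)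
    qed
  qed
  finally show ?thesis .
qed

section \<open>Pluecker relations on the scheme-theoretic image\<close>

text \<open>
  The evaluation of an integral polynomial is a sum over its support. Over a larger finite set of
  monomials the sum is the same, which makes additivity visible.
\<close>

lemma zeval_add: "zeval v (p + q) = zeval v p + zeval v q"
proof -
  let ?t = "\<lambda>p m. of_int (Poly_Mapping.lookup p m) *
     (\<Prod>x \<in> Poly_Mapping.keys m. v x ^ Poly_Mapping.lookup m x)"
  let ?K = "Poly_Mapping.keys p \<union> Poly_Mapping.keys q"
  have ext: "zeval v r = sum (?t r) ?K" if "Poly_Mapping.keys r \<subseteq> ?K" for r
    unfolding zeval_def using that
    by (intro sum.mono_neutral_left) (auto simp: in_keys_iff)
  show ?thesis
    using Poly_Mapping.keys_add[of p q]
    by (simp add: ext lookup_add sum.distrib[symmetric] distrib_right)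
qed

definition quadratic_monom :: "int \<Rightarrow> 'v \<Rightarrow> 'v \<Rightarrow> 'v zpoly" where
  "quadratic_monom c x y =
    Poly_Mapping.single (Poly_Mapping.single x 1 + Poly_Mapping.single y 1) c"

lemma keys_single_add_single:
  "Poly_Mapping.keys (Poly_Mapping.single x (Suc 0) + Poly_Mapping.single y (Suc 0)) = {x, y}"
  by (auto simp: in_keys_iff lookup_add lookup_single when_def split: if_splits)

lemma zeval_quadratic_monom:
  assumes "x \<noteq> y"
  shows "zeval v (quadratic_monom c x y) = of_int c * (v x * v y)"
  using assms
  by (auto simp: zeval_def quadratic_monom_def keys_single_add_single lookup_add lookup_single)

lemma indets_add: "indets (p + q) \<subseteq> indets p \<union> indets q"
  using Poly_Mapping.keys_add[of p q] by (auto simp: indets_def)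

lemma indets_quadratic_monom: "indets (quadratic_monom c x y) \<subseteq> {x, y}"
  by (auto simp: indets_def quadratic_monom_def keys_single_add_single split: if_splits)

text \<open>
  The relation in column \<open>m\<close>. The arguments \<open>ab, \<dots>, bc\<close> are single numbers: the positions in
  \<open>pairs\<close> of the subsets \<open>{a, b}, \<dots>, {b, c}\<close>.
\<close>

definition plucker_poly ::
  "nat \<Rightarrow> nat \<Rightarrow> nat \<Rightarrow> nat \<Rightarrow> nat \<Rightarrow> nat \<Rightarrow> nat \<Rightarrow> gl_var zpoly" where
  "plucker_poly m ab cd ac bd ad bc =
    quadratic_monom 1 (Entry ab m) (Entry cd m) +
    quadratic_monom (- 1) (Entry ac m) (Entry bd m) +
    quadratic_monom 1 (Entry ad m) (Entry bc m)"

lemma gl_eval_plucker_poly: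
  assumes "ab \<noteq> cd" "ac \<noteq> bd" "ad \<noteq> bc"
  shows "gl_eval (plucker_poly m ab cd ac bd ad bc) A B =
    A $$ (ab, m) * A $$ (cd, m) - A $$ (ac, m) * A $$ (bd, m) + A $$ (ad, m) * A $$ (bc, m)"
  using assms by (simp add: gl_eval_def plucker_poly_def zeval_add zeval_quadratic_monom)

text \<open>
  At the exterior square of a matrix, a column lists the \<open>2 \<times> 2\<close> minors of two columns of the
  matrix, and these minors satisfy the Pluecker relation as an identity over every
  commutative ring. So the relation takes the value \<open>0\<close> at the generic matrix, not only a value
  in the defining ideal of the general linear group scheme.
\<close>

lemma plucker_in_wedge2_kernel:
  assumes m: "m < n choose 2"
    and ab: "ab < n choose 2" "pairs n ! ab = (a, b)"
    and cd: "cd < n choose 2" "pairs n ! cd = (c, d)"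
    and ac: "ac < n choose 2" "pairs n ! ac = (a, c)"
    and bd: "bd < n choose 2" "pairs n ! bd = (b, d)"
    and ad: "ad < n choose 2" "pairs n ! ad = (a, d)"
    and bc: "bc < n choose 2" "pairs n ! bc = (b, c)"
    and ne: "ab \<noteq> cd" "ac \<noteq> bd" "ad \<noteq> bc"
  shows "plucker_poly m ab cd ac bd ad bc \<in> wedge2_kernel n"
proof -
  let ?P = "plucker_poly m ab cd ac bd ad bc"
  have "indets ?P \<subseteq> {Entry i m | i. i \<in> {ab, cd, ac, bd, ad, bc}}"
    unfolding plucker_poly_def
    by (intro order.trans[OF indets_add] Un_least order.trans[OF indets_quadratic_monom]) auto
  also have "\<dots> \<subseteq> gl_vars (n choose 2)"
    using assms by (auto simp: gl_vars_def)
  finally have vars: "indets ?P \<subseteq> gl_vars (n choose 2)" .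
  have gen: "generic_mat n \<in> carrier_mat n n" by (simp add: generic_mat_def)
  obtain j1 j2 where j: "pairs n ! m = (j1, j2)" by force
  note minor = wedge2_index[OF gen _ m _ j]
  have "gl_eval ?P (wedge2 (generic_mat n)) (wedge2 (generic_inv n)) = 0"
    by (simp add: gl_eval_plucker_poly[OF ne] minor[OF ab] minor[OF cd] minor[OF ac]
        minor[OF bd] minor[OF ad] minor[OF bc] algebra_simps)
  moreover have "0 \<in> gl_ideal n"
  proof -
    interpret Modules.module "(*) :: gl_var zpoly \<Rightarrow> _"
      by unfold_locales (simp_all add: algebra_simps)
    show ?thesis unfolding gl_ideal_def by (rule span_zero)
  qed
  ultimately show ?thesis using vars by (simp add: wedge2_kernel_def)
qed

lemma column_plucker:
  fixes g :: "'a::comm_ring_1 mat"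
  assumes g: "g \<in> wedge2_GL n" and w: "w \<in> set (cols g)"
    and abcd: "1 \<le> a" "a < b" "b < c" "c < d" "d \<le> n"
  shows "alt_coord n w a b * alt_coord n w c d - alt_coord n w a c * alt_coord n w b d
    + alt_coord n w a d * alt_coord n w b c = 0"
proof -
  obtain B where gc: "g \<in> carrier_mat (n choose 2) (n choose 2)"
    and ker: "\<And>p. p \<in> wedge2_kernel n \<Longrightarrow> gl_eval p g B = 0"
    using g by (auto simp: wedge2_GL_def)
  obtain m where m: "m < n choose 2" "w = col g m"
    using w gc by (auto simp: cols_def)
  obtain ab where ab: "ab < n choose 2" "pairs n ! ab = (a, b)"
    by (rule obtain_pair_index[of a b n]) (use abcd in auto)
  obtain cd where cd: "cd < n choose 2" "pairs n ! cd = (c, d)"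
    by (rule obtain_pair_index[of c d n]) (use abcd in auto)
  obtain ac where ac: "ac < n choose 2" "pairs n ! ac = (a, c)"
    by (rule obtain_pair_index[of a c n]) (use abcd in auto)
  obtain bd where bd: "bd < n choose 2" "pairs n ! bd = (b, d)"
    by (rule obtain_pair_index[of b d n]) (use abcd in auto)
  obtain ad where ad: "ad < n choose 2" "pairs n ! ad = (a, d)"
    by (rule obtain_pair_index[of a d n]) (use abcd in auto)
  obtain bc where bc: "bc < n choose 2" "pairs n ! bc = (b, c)"
    by (rule obtain_pair_index[of b c n]) (use abcd in auto)
  have ne: "ab \<noteq> cd" "ac \<noteq> bd" "ad \<noteq> bc"
    using abcd ab cd ac bd ad bc by auto
  have coord: "alt_coord n w i j = g $$ (k, m)" if "k < n choose 2" "pairs n ! k = (i, j)" for i j k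
    using that(1) nth_pairs_bounds[OF that] m gc
    by (simp add: alt_coord_less length_pairs wedge2_coord_nth[OF _ that(2)])
  show ?thesis
    using ker[OF plucker_in_wedge2_kernel[OF m(1) ab cd ac bd ad bc ne]]
    by (simp add: gl_eval_plucker_poly[OF ne] coord[OF ab] coord[OF cd] coord[OF ac]
        coord[OF bd] coord[OF ad] coord[OF bc])
qed

text \<open>
  The relation for an arbitrary fourth label \<open>k\<close>: the left-hand side is alternating in the four
  labels, so it is up to sign the relation for the sorted labels, or \<open>0\<close> if \<open>k\<close> is repeated.
\<close>

lemma column_plucker_any:
  fixes g :: "'a::comm_ring_1 mat"
  assumes g: "g \<in> wedge2_GL n" and w: "w \<in> set (cols g)"
    and qrs: "1 \<le> q" "q < r" "r < s" "s \<le> n" and k: "1 \<le> k" "k \<le> n"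
  shows "alt_coord n w r s * alt_coord n w q k + - alt_coord n w q s * alt_coord n w r k
    + alt_coord n w q r * alt_coord n w s k = 0"
proof -
  note plucker = column_plucker[OF g w]
  consider "k < q" | "k = q" | "q < k" "k < r" | "k = r" | "r < k" "k < s" | "k = s" | "s < k"
    by linarith
  then show ?thesis
  proof cases
    case 1
    then show ?thesis
      using plucker[of k q r s] qrs k alt_coord_swap[of n w q k] alt_coord_swap[of n w r k]
        alt_coord_swap[of n w s k]
      by (simp add: algebra_simps add_eq_0_iff2)
  next
    case 2
    then show ?thesis using alt_coord_swap[of n w r k] alt_coord_swap[of n w s k] by simp
  next
    case 3
    then show ?thesis
      using plucker[of q k r s] qrs k alt_coord_swap[of n w r k] alt_coord_swap[of n w s k]
      by (simp add: algebra_simps)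
  next
    case 4
    then show ?thesis using alt_coord_swap[of n w s k] by simp
  next
    case 5
    then show ?thesis
      using plucker[of q r k s] qrs k alt_coord_swap[of n w s k]
      by (simp add: algebra_simps add_eq_0_iff2)
  next
    case 6
    then show ?thesis by (simp add: algebra_simps)
  next
    case 7
    then show ?thesis using plucker[of q r s k] qrs k by (simp add: algebra_simps)
  qed
qed

section \<open>Transvections fixing a column\<close>

theorem theorem2:
  fixes n :: nat and g T\<^sub>1 :: "'a::comm_ring_1 mat" and w :: "'a vec"
  assumes "n \<ge> 5"
    and "g \<in> wedge2_GL n"
    and "w \<in> set (cols g)"
    and "T\<^sub>1 = wedge2 (transvection n 2 3 (wedge2_coord n w 4 5))
            * wedge2 (transvection n 2 4 (- wedge2_coord n w 3 5))
            * wedge2 (transvection n 2 5 (wedge2_coord n w 3 4))"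
  shows "T\<^sub>1 *\<^sub>v w = w"
proof -
  have w: "w \<in> carrier_vec (n choose 2)"
    using assms(2,3) by (auto simp: wedge2_GL_def cols_def)
  show ?thesis
    unfolding assms(4)
  proof (rule wedge2_transvections_fix[OF w])
    fix k assume "1 \<le> k" "k \<le> n"
    then show "wedge2_coord n w 4 5 * alt_coord n w 3 k
        + - wedge2_coord n w 3 5 * alt_coord n w 4 k + wedge2_coord n w 3 4 * alt_coord n w 5 k = 0"
      using column_plucker_any[OF assms(2,3), of 3 4 5 k] assms(1)
      by (simp add: alt_coord_less)
  qed (use assms(1) in auto)
qed

end
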